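(* Let $G=\mathbb{R}^4$ with the Lorentz metric $ds^2=dx_0^2+2e^{x_1}dx_0\,dx_2+\frac{e^{2x_1}}{2}dx_2^2-dx_1^2-dx_3^2$, and let $G_0=\{x_3=0\}$. A future-directed timelike geodesic in $(G,ds^2)$, parametrized so that $ds^2(\gamma',\gamma')=1$, starting at the unit $(0,0,0,0)$ of $G$ (at $t=0$) and not lying in the subgroup $G_0$, can have one of two forms, where $\varphi_0$ is the constant value of $x_0'+e^{x_1}x_2'$ along the geodesic: (i) $x_0(t)=\varphi_0t,\quad x_3(t)=\sqrt{\varphi_0^2-1}\,t,\quad x_1(t)=x_2(t)\equiv0,\quad t\in\mathbb{R},\quad \varphi_0>1$; (ii) $\gamma(t)=(\tilde\gamma(t),\varphi_3t)$, $0<|\varphi_3|<\sqrt{\varphi_0^2-1}$, $t\in\mathbb{R}$, where $\varphi_3t$ is the $x_3$-coordinate and $\tilde\gamma(t)=(x_0(t),x_1(t),x_2(t))$ is given, for some $t_0\in\mathbb{R}$, with $$\alpha=\frac{\sqrt2-\sqrt{1-(1+\varphi_3^2)/\varphi_0^2}}{\sqrt2+\sqrt{1-(1+\varphi_3^2)/\varphi_0^2}},\qquad \omega=\sqrt{\varphi_0^2+1+\varphi_3^2},$$ by $$x_0(t)=-\varphi_0(t-t_0)+2\sqrt2\arctan\left(\sqrt{\alpha}\tan\left(\tfrac{\omega(t-t_0)}{2}\right)\right)-\left[\varphi_0t_0+2\sqrt2\arctan\left(\sqrt{\alpha}\tan\left(\tfrac{-\omega t_0}{2}\right)\right)\right],$$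 $$x_1(t)=\ln\big((1+\alpha)+(1-\alpha)\cos\tau\big)\Big|_{\tau=-\omega t_0}^{\tau=\omega(t-t_0)},$$ $$x_2(t)=\frac{\beta\sin\tau}{(1+\alpha)+(1-\alpha)\cos\tau}\Big|_{\tau=-\omega t_0}^{\tau=\omega(t-t_0)},\qquad \beta=\frac{\sqrt{2(\varphi_0^2-(1+\varphi_3^2))}}{\sqrt{\varphi_0^2+1+\varphi_3^2}}\big[(1+\alpha)+(1-\alpha)\cos(\omega t_0)\big].$$
   Context: $G$ is a Lie group on $\mathbb{R}^4$ with coordinates $(x_0,x_1,x_2,x_3)$, unit $0$, and left translations $(x_0',x_1',x_2',x_3')\mapsto(x_0'+p,\;x_1'+q,\;x_2'e^{-q}+c,\;x_3'+d)$ by the element $(p,q,c,d)$; $ds^2$ (signature $(+,-,-,-)$) is left-invariant. The left-invariant fields $e_0=\partial_{x_0}$, $e_1=\partial_{x_1}$, $e_2'=\sqrt2(\partial_{x_0}-e^{-x_1}\partial_{x_2})$, $e_3=\partial_{x_3}$ form an orthonormal frame. Along a geodesic the $e_0$-component of $\gamma'$ in this frame, $\varphi_0=x_0'+e^{x_1}x_2'$, is constant; future-directed means $\varphi_0>0$. Convention: for a constant $\kappa>0$, the expression $\arctan(\kappa\tan s)$, $s\in\mathbb{R}$, denotes the continuous function of $s$ on $\mathbb{R}$ equal to the principal value on $(-\pi/2,\pi/2)$; i.e. it equals the principal arctangent of $\kappa\tan s$ plus $k\pi$ for $|s-k\pi|<\pi/2$, and equals $\pi/2+k\pi$ at $s=\pi/2+k\pi$,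 $k\in\mathbb{Z}$. The notation $F(\tau)|_{\tau=A}^{\tau=B}$ means $F(B)-F(A)$.
   Formalization: In form (i) the formal statement allows x_3(t) = ±√(φ_0²−1) t; with only the printed plus sign the classification fails, since (φ_0 t, 0, 0, −√(φ_0²−1) t), φ_0>1, is also such a geodesic and is of neither form. *)

theory Defs
  imports "HOL-Analysis.Analysis"
begin

text \<open>
  A metric on \<open>real^'n\<close> is given by its Gram matrix \<open>g x\<close> in the coordinate
  frame at the point \<open>x\<close>; no positivity is required.
\<close>

definition metric_form :: "(real^'n \<Rightarrow> real^'n^'n) \<Rightarrow> real^'n \<Rightarrow> real^'n \<Rightarrow> real^'n \<Rightarrow> real" where
  "metric_form g x v w = (\<Sum>i\<in>UNIV. \<Sum>j\<in>UNIV. g x $ i $ j * v $ i * w $ j)"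

definition metric_partial ::
  "(real^'n \<Rightarrow> real^'n^'n) \<Rightarrow> real^'n \<Rightarrow> 'n \<Rightarrow> 'n \<Rightarrow> 'n \<Rightarrow> real" where
  "metric_partial g x k i j = deriv (\<lambda>s. g (x + s *\<^sub>R axis k 1) $ i $ j) 0"

definition christoffel ::
  "(real^'n \<Rightarrow> real^'n^'n) \<Rightarrow> real^'n \<Rightarrow> 'n \<Rightarrow> 'n \<Rightarrow> 'n \<Rightarrow> real" where
  "christoffel g x k i j =
     (1/2) * (\<Sum>l\<in>UNIV. matrix_inv (g x) $ k $ l *
       (metric_partial g x i l j + metric_partial g x j l i - metric_partial g x l i j))"

definition velocity :: "(real \<Rightarrow> real^'n) \<Rightarrow> real \<Rightarrow> real^'n" where
  "velocity \<gamma> t = vector_derivative \<gamma> (at t)"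

text \<open>Intended for an open interval \<open>I\<close>, since the derivatives are two-sided.\<close>

definition geodesic_on ::
  "(real^'n \<Rightarrow> real^'n^'n) \<Rightarrow> real set \<Rightarrow> (real \<Rightarrow> real^'n) \<Rightarrow> bool" where
  "geodesic_on g I \<gamma> \<longleftrightarrow>
     (\<forall>t\<in>I. \<gamma> differentiable (at t) \<and> velocity \<gamma> differentiable (at t) \<and>
       (\<forall>k. velocity (velocity \<gamma>) t $ k +
          (\<Sum>i\<in>UNIV. \<Sum>j\<in>UNIV.
             christoffel g (\<gamma> t) k i j * velocity \<gamma> t $ i * velocity \<gamma> t $ j) = 0))"

text \<open>
  The elements of the index type \<open>4\<close> are \<open>0, 1, 2, 3\<close> (with \<open>4 = 0\<close>), so
  \<open>x $ 0, x $ 1, x $ 2, x $ 3\<close> are the four coordinates of \<open>x :: real^4\<close>.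
  The off-diagonal entries are half the coefficient of \<open>dx_0 dx_2\<close> in
  \<open>dx_0^2 + 2 e^{x_1} dx_0 dx_2 + (e^{2 x_1} / 2) dx_2^2 - dx_1^2 - dx_3^2\<close>.
\<close>

definition goedel_metric :: "real^4 \<Rightarrow> real^4^4" where
  "goedel_metric x = (\<chi> i j.
     if i = 0 \<and> j = 0 then 1
     else if (i = 0 \<and> j = 2) \<or> (i = 2 \<and> j = 0) then exp (x $ 1)
     else if i = 2 \<and> j = 2 then exp (2 * x $ 1) / 2
     else if i = 1 \<and> j = 1 \<or> i = 3 \<and> j = 3 then - 1
     else 0)"

text \<open>
  Component along \<open>e_0\<close> of a tangent vector \<open>v\<close> at \<open>x\<close>, in the left-invariant
  orthonormal frame \<open>e_0 = \<partial>_0\<close>, \<open>e_1 = \<partial>_1\<close>,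
  \<open>e_2' = sqrt 2 (\<partial>_0 - e^{-x_1} \<partial>_2)\<close>, \<open>e_3 = \<partial>_3\<close>.
\<close>

definition e0_component :: "real^4 \<Rightarrow> real^4 \<Rightarrow> real" where
  "e0_component x v = v $ 0 + exp (x $ 1) * v $ 2"

definition future_directed_on :: "real set \<Rightarrow> (real \<Rightarrow> real^4) \<Rightarrow> bool" where
  "future_directed_on I \<gamma> \<longleftrightarrow> (\<forall>t\<in>I. e0_component (\<gamma> t) (velocity \<gamma> t) > 0)"

definition G0 :: "(real^4) set" where
  "G0 = {x. x $ 3 = 0}"

text \<open>
  The continuous branch on the whole line of \<open>arctan (\<kappa> tan s)\<close>, \<open>\<kappa> > 0\<close>,
  that is the principal value on \<open>(-pi/2, pi/2)\<close>; see the two lemmas below.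
\<close>

definition arctan_tan :: "real \<Rightarrow> real \<Rightarrow> real" where
  "arctan_tan \<kappa> s =
     (if cos s = 0 then s else arctan (\<kappa> * tan s) + of_int (round (s / pi)) * pi)"

lemma arctan_tan_branch:
  fixes k :: int
  assumes "\<bar>s - of_int k * pi\<bar> < pi / 2"
  shows "arctan_tan \<kappa> s = arctan (\<kappa> * tan s) + of_int k * pi"
proof -
  have r: "round (s / pi) = k"
  proof (rule round_unique')
    have "\<bar>s / pi - of_int k\<bar> = \<bar>s - of_int k * pi\<bar> / pi"
      by (simp add: abs_if field_simps)
    also have "\<dots> < 1 / 2"
      using assms by (simp add: field_simps)
    finally show "\<bar>s / pi - of_int k\<bar> < 1 / 2" .
  qed
  have "cos (s - of_int k * pi) > 0"
    using assms unfolding abs_less_iff by (intro cos_gt_zero_pi) linarith+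
  moreover have "sin (of_int k * pi) = (0::real)"
    by (metis sin_times_pi_eq_0 Ints_of_int)
  ultimately have "cos s \<noteq> 0"
    by (auto simp: cos_diff)
  then show ?thesis
    using r by (simp add: arctan_tan_def)
qed

lemma arctan_tan_half:
  fixes k :: int
  shows "arctan_tan \<kappa> (pi / 2 + of_int k * pi) = pi / 2 + of_int k * pi"
proof -
  have "sin (of_int k * pi) = (0::real)"
    by (metis sin_times_pi_eq_0 Ints_of_int)
  then have "cos (pi / 2 + of_int k * pi) = 0"
    by (simp add: cos_add)
  then show ?thesis
    by (simp add: arctan_tan_def)
qed

definition eval_between :: "(real \<Rightarrow> real) \<Rightarrow> real \<Rightarrow> real \<Rightarrow> real" where
  "eval_between F A B = F B - F A"

end

theory Submission
  imports Defs
begin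

text \<open>
  Write \<open>E = e^{x_1}\<close>. Along a geodesic the quantities
  \<open>\<phi> = x_0' + E x_2'\<close>, \<open>c = E x_0' + E^2 x_2' / 2\<close> and \<open>x_3'\<close>, up to sign the momenta of the cyclic
  coordinates, are constant, so that \<open>E x_2' = 2 \<phi> - 2 c / E\<close>. Inserting this into the
  equation for \<open>x_1\<close> and using the unit speed normalisation, one finds the linear oscillator
  \<open>E'' = - \<omega>^2 E + 2 c \<phi>\<close>, \<open>\<omega>^2 = \<phi>^2 + 1 + x_3'^2\<close>. Hence
  \<open>E(t) = (1 + q cos (\<omega> (t - t_0))) / (1 + q cos (\<omega> t_0))\<close>, where the ``eccentricity''
  \<open>q \<in> [0, 1)\<close> is given by \<open>1 + x_3'^2 = \<phi>^2 (1 - 2 q^2)\<close>, and \<open>x_0\<close>, \<open>x_2\<close> follow by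
  integration. The form (i) is the circular case \<open>q = 0\<close>; in the form (ii),
  \<open>\<alpha> = (1 - q) / (1 + q)\<close>.
\<close>

section \<open>Geodesics as scalar differential equations in coordinates\<close>

lemma has_vector_derivative_vec_iff:
  fixes f :: "real \<Rightarrow> real^'n"
  shows "(f has_vector_derivative D) (at t) \<longleftrightarrow>
    (\<forall>k. ((\<lambda>t. f t $ k) has_real_derivative D $ k) (at t))"
proof
  assume "(f has_vector_derivative D) (at t)"
  then show "\<forall>k. ((\<lambda>t. f t $ k) has_real_derivative D $ k) (at t)"
    by (auto simp: has_real_derivative_iff_has_vector_derivative
        intro: bounded_linear.has_vector_derivative[OF bounded_linear_vec_nth])
next
  have expand: "(\<Sum>k\<in>UNIV. x $ k *\<^sub>R axis k 1) = x" for x :: "real^'n"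
    using basis_expansion[of x] by (simp add: scalar_mult_eq_scaleR)
  assume "\<forall>k. ((\<lambda>t. f t $ k) has_real_derivative D $ k) (at t)"
  then have "((\<lambda>t. \<Sum>k\<in>UNIV. f t $ k *\<^sub>R axis k (1::real)) has_vector_derivative
      (\<Sum>k\<in>UNIV. D $ k *\<^sub>R axis k 1)) (at t)"
    by (auto simp: has_real_derivative_iff_has_vector_derivative
        intro!: has_vector_derivative_sum
          bounded_linear.has_vector_derivative[OF bounded_linear_scaleR_left])
  then show "(f has_vector_derivative D) (at t)"
    by (simp only: expand)
qed

lemma geodesic_onD:
  assumes "geodesic_on g I \<gamma>" "t \<in> I"
  shows "((\<lambda>t. \<gamma> t $ k) has_real_derivative velocity \<gamma> t $ k) (at t)"
    and "((\<lambda>t. velocity \<gamma> t $ k) has_real_derivative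
      - (\<Sum>i\<in>UNIV. \<Sum>j\<in>UNIV.
          christoffel g (\<gamma> t) k i j * velocity \<gamma> t $ i * velocity \<gamma> t $ j)) (at t)"
proof -
  have "(\<gamma> has_vector_derivative velocity \<gamma> t) (at t)"
    using assms by (auto simp: geodesic_on_def velocity_def vector_derivative_works[symmetric])
  then show "((\<lambda>t. \<gamma> t $ k) has_real_derivative velocity \<gamma> t $ k) (at t)"
    by (simp add: has_vector_derivative_vec_iff)
  have "(velocity \<gamma> has_vector_derivative velocity (velocity \<gamma>) t) (at t)"
    using assms by (auto simp: geodesic_on_def velocity_def[of "velocity \<gamma>"]
        vector_derivative_works[symmetric])
  moreover have "velocity (velocity \<gamma>) t $ k = - (\<Sum>i\<in>UNIV. \<Sum>j\<in>UNIV.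
          christoffel g (\<gamma> t) k i j * velocity \<gamma> t $ i * velocity \<gamma> t $ j)"
    using assms by (auto simp: geodesic_on_def eq_neg_iff_add_eq_0)
  ultimately show "((\<lambda>t. velocity \<gamma> t $ k) has_real_derivative
      - (\<Sum>i\<in>UNIV. \<Sum>j\<in>UNIV.
          christoffel g (\<gamma> t) k i j * velocity \<gamma> t $ i * velocity \<gamma> t $ j)) (at t)"
    by (simp only: has_vector_derivative_vec_iff) metis
qed

lemma velocity_eqI:
  assumes "\<And>k. ((\<lambda>t. \<gamma> t $ k) has_real_derivative v $ k) (at t)"
  shows "velocity \<gamma> t = v"
  using assms by (simp add: velocity_def vector_derivative_at has_vector_derivative_vec_iff)

text \<open>The candidate \<open>v\<close> is known to be the velocity only on \<open>I\<close>.
  Since \<open>I\<close> is open, the agreement holds near each of its points, so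
  \<open>velocity \<gamma>\<close> and \<open>v\<close> also have the same derivative there.\<close>

lemma geodesic_onI:
  assumes "open I"
    and v: "\<And>t k. t \<in> I \<Longrightarrow> ((\<lambda>t. \<gamma> t $ k) has_real_derivative v t $ k) (at t)"
    and a: "\<And>t k. t \<in> I \<Longrightarrow> ((\<lambda>t. v t $ k) has_real_derivative
      - (\<Sum>i\<in>UNIV. \<Sum>j\<in>UNIV. christoffel g (\<gamma> t) k i j * v t $ i * v t $ j)) (at t)"
  shows "geodesic_on g I \<gamma>"
  unfolding geodesic_on_def
proof (intro ballI conjI allI)
  fix t k assume t: "t \<in> I"
  define A where "A = (\<chi> k. - (\<Sum>i\<in>UNIV. \<Sum>j\<in>UNIV. christoffel g (\<gamma> t) k i j * v t $ i * v t $ j))"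
  have vel: "velocity \<gamma> s = v s" if "s \<in> I" for s
    using v that by (intro velocity_eqI)
  have "(v has_vector_derivative A) (at t)"
    using a t by (simp add: has_vector_derivative_vec_iff A_def)
  then have A: "(velocity \<gamma> has_vector_derivative A) (at t)"
    by (rule has_vector_derivative_transform_within_open[OF _ \<open>open I\<close> t]) (simp add: vel)
  have "(\<gamma> has_vector_derivative v t) (at t)"
    using v t by (simp add: has_vector_derivative_vec_iff)
  then show "\<gamma> differentiable (at t)"
    by (rule differentiableI_vector)
  show "velocity \<gamma> differentiable (at t)"
    using A by (rule differentiableI_vector)
  have "velocity (velocity \<gamma>) t = A"
    using A by (simp add: velocity_def[of "velocity \<gamma>"] vector_derivative_at)
  then show "velocity (velocity \<gamma>) t $ k + (\<Sum>i\<in>UNIV. \<Sum>j\<in>UNIV.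
      christoffel g (\<gamma> t) k i j * velocity \<gamma> t $ i * velocity \<gamma> t $ j) = 0"
    by (simp add: vel t A_def)
qed

section \<open>The Goedel metric, its inverse and its Christoffel symbols\<close>

lemma four_eq_zero: "(4 :: 4) = 0"
  unfolding iszero_def[symmetric] by simp

text \<open>The generic expansion runs over 1, 2, 3, 4; rewriting 4 to 0 adapts it to the numbering
  of the coordinates.\<close>

lemma sum_0123: "sum f (UNIV :: 4 set) = f 0 + f 1 + f 2 + f 3"
  by (simp add: sum_4 four_eq_zero ac_simps)

lemma forall_0123: "(\<forall>k::4. P k) \<longleftrightarrow> P 0 \<and> P 1 \<and> P 2 \<and> P 3"
  using forall_4[of P] by (auto simp: four_eq_zero)

lemma exp_twice: "exp (x * 2) = (exp x)\<^sup>2" for x :: real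
  by (metis exp_double mult.commute)

text \<open>Completing the square in dx_0 diagonalises the form. Up to sign,
  \<open>exp (x $ 1) * v $ 2 / sqrt 2\<close> is the component along e_2', so this is the metric
  read in the orthonormal frame.\<close>

lemma metric_form_goedel:
  "metric_form goedel_metric x v v =
    (e0_component x v)\<^sup>2 - (exp (x $ 1) * v $ 2)\<^sup>2 / 2 - (v $ 1)\<^sup>2 - (v $ 3)\<^sup>2"
  by (simp add: metric_form_def sum_0123 goedel_metric_def e0_component_def
      exp_twice power2_eq_square algebra_simps)

lemma metric_partial_goedel:
  "metric_partial goedel_metric x k i j =
    (if k \<noteq> 1 then 0
     else if i = 0 \<and> j = 2 \<or> i = 2 \<and> j = 0 then exp (x $ 1)
     else if i = 2 \<and> j = 2 then exp (2 * x $ 1)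
     else 0)"
proof -
  \<comment> \<open>Every entry is a combination of 1, E and E^2 with constant coefficients, so one
    differentiation serves all index pairs.\<close>
  define c0 c1 c2 :: real where
    "c0 = (if i = 0 \<and> j = 0 then 1 else if i = 1 \<and> j = 1 \<or> i = 3 \<and> j = 3 then - 1 else 0)"
    and "c1 = (if i = 0 \<and> j = 2 \<or> i = 2 \<and> j = 0 then 1 else 0)"
    and "c2 = (if i = 2 \<and> j = 2 then 1 / 2 else 0)"
  have "goedel_metric y $ i $ j = c0 + c1 * exp (y $ 1) + c2 * exp (2 * y $ 1)" for y
    by (auto simp: goedel_metric_def c0_def c1_def c2_def)
  then have "metric_partial goedel_metric x k i j =
      (if k = 1 then c1 * exp (x $ 1) + 2 * c2 * exp (2 * x $ 1) else 0)"
    unfolding metric_partial_def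
    by (intro DERIV_imp_deriv) (auto simp: axis_def intro!: derivative_eq_intros)
  then show ?thesis
    by (auto simp: c1_def c2_def)
qed

text \<open>A right inverse of a square matrix over a field is two-sided. This supplies the
  existence that the choice in \<open>matrix_inv\<close> rests on, and uniqueness of inverses does
  the rest.\<close>

lemma matrix_inv_eqI:
  fixes A B :: "'a::field^'n^'n"
  assumes "A ** B = mat 1"
  shows "matrix_inv A = B"
proof -
  have "\<exists>X. A ** X = mat 1 \<and> X ** A = mat 1"
    using assms matrix_left_right_inverse by blast
  then have "matrix_inv A ** A = mat 1"
    unfolding matrix_inv_def by (rule someI2_ex) simp
  then have "matrix_inv A ** (A ** B) = B"
    by (simp add: matrix_mul_assoc)
  then show ?thesis
    by (simp add: assms)
qed

lemma matrix_inv_goedel: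
  "matrix_inv (goedel_metric x) = (\<chi> i j.
     if i = 0 \<and> j = 0 then - 1
     else if (i = 0 \<and> j = 2) \<or> (i = 2 \<and> j = 0) then 2 * exp (- x $ 1)
     else if i = 2 \<and> j = 2 then - 2 * exp (- 2 * x $ 1)
     else if i = 1 \<and> j = 1 \<or> i = 3 \<and> j = 3 then - 1
     else 0)" (is "_ = ?B")
proof -
  have "goedel_metric x ** ?B = mat 1"
    by (simp add: vec_eq_iff forall_0123 matrix_matrix_mult_def sum_0123 goedel_metric_def
        mat_def exp_minus exp_twice field_simps power2_eq_square)
  then show ?thesis
    by (rule matrix_inv_eqI)
qed

text \<open>Only these contractions enter the geodesic equation, so the individual symbols are never
  listed.\<close>

lemma christoffel_sum_goedel:
  fixes v :: "real^4"
  defines "\<Gamma> \<equiv> \<lambda>x k. \<Sum>i\<in>UNIV. \<Sum>j\<in>UNIV. christoffel goedel_metric x k i j * v $ i * v $ j"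
  shows "\<Gamma> x 0 = 2 * v $ 0 * v $ 1 + exp (x $ 1) * v $ 1 * v $ 2"
    and "\<Gamma> x 1 = exp (x $ 1) * v $ 0 * v $ 2 + exp (2 * x $ 1) * (v $ 2)\<^sup>2 / 2"
    and "\<Gamma> x 2 = - 2 * exp (- x $ 1) * v $ 0 * v $ 1"
    and "\<Gamma> x 3 = 0"
  by (simp_all add: \<Gamma>_def sum_0123 christoffel_def matrix_inv_goedel metric_partial_goedel
      exp_minus exp_twice field_simps power2_eq_square)

section \<open>The continuous branch of arctan (\<kappa> tan s) and its derivative\<close>

lemma cos_sin_form_pos:
  fixes s \<kappa> :: real
  assumes "\<kappa> > 0"
  shows "(cos s)\<^sup>2 + \<kappa> * (sin s)\<^sup>2 > 0"
  using assms sin_cos_squared_add[of s]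
  by (cases "sin s = 0") (auto intro: add_nonneg_pos)

text \<open>The subtraction formula for \<open>tan\<close> merges all pieces of the branch into one smooth expression.\<close>

lemma arctan_tan_eq:
  assumes "\<kappa> > 0"
  shows "arctan_tan \<kappa> s = s + arctan ((\<kappa> - 1) * sin s * cos s / ((cos s)\<^sup>2 + \<kappa> * (sin s)\<^sup>2))"
proof (cases "cos s = 0")
  \<comment> \<open>The numerator of the correction contains the factor \<open>cos s\<close>, so the
    correction vanishes here and the value \<open>s\<close> chosen in the definition fits.\<close>
  case True
  then show ?thesis by (simp add: arctan_tan_def)
next
  case False
  define k where "k = round (s / pi)"
  define r where "r = s - of_int k * pi"
  have sk: "sin (of_int k * pi) = (0::real)"
    by (metis sin_times_pi_eq_0 Ints_of_int)
  have ck: "(cos (of_int k * pi))\<^sup>2 = (1::real)"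
    using sin_cos_squared_add[of "of_int k * pi"] sk by simp
  have s: "s = r + of_int k * pi"
    by (simp add: r_def)
  have cr: "cos r \<noteq> 0"
    using False sk by (auto simp: s cos_add)
  \<comment> \<open>Rounding gives only a closed bound on \<open>r\<close>; the endpoints are
    excluded because the cosine vanishes there.\<close>
  have "\<bar>of_int k - s / pi\<bar> \<le> 1 / 2"
    unfolding k_def by (rule of_int_round_abs_le)
  then have "\<bar>r\<bar> \<le> pi / 2"
    by (auto simp: r_def abs_if field_simps split: if_splits)
  moreover have "\<bar>r\<bar> \<noteq> pi / 2"
    using cr cos_pi_half cos_minus[of "pi / 2"] by (metis abs_eq_iff' abs_minus_cancel abs_of_nonneg pi_half_ge_zero)
  ultimately have r: "\<bar>r\<bar> < pi / 2" by linarith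
  have tan: "tan s = tan r"
    using sk ck by (auto simp: tan_def s sin_add cos_add power2_eq_1_iff)
  define \<theta> where "\<theta> = arctan (\<kappa> * tan r)"
  have \<theta>: "\<bar>\<theta>\<bar> < pi / 2" "tan \<theta> = \<kappa> * tan r" "cos \<theta> \<noteq> 0"
    using arctan_bounded[of "\<kappa> * tan r"] by (auto simp: \<theta>_def abs_less_iff tan_arctan)
  \<comment> \<open>Since \<kappa> > 0, \<open>\<theta>\<close> and \<open>r\<close> have the same
    sign, so their difference stays in the principal range and is recovered from its
    tangent.\<close>
  have "\<bar>\<theta> - r\<bar> < pi / 2"
  proof (cases "r \<ge> 0")
    case True
    then have "tan r \<ge> 0"
      using r tan_gt_zero[of r] by (cases "r = 0") auto
    then have "\<theta> \<ge> 0" using assms by (simp add: \<theta>_def)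
    then show ?thesis using \<theta> r True by (auto simp: abs_if split: if_splits)
  next
    case False
    then have "tan r < 0"
      using r tan_gt_zero[of "- r"] by auto
    then have "\<theta> < 0" using assms by (simp add: \<theta>_def mult_pos_neg)
    then show ?thesis using \<theta> r False by (auto simp: abs_if split: if_splits)
  qed
  then have b: "- (pi / 2) < \<theta> - r" "\<theta> - r < pi / 2" by linarith+
  then have "cos (\<theta> - r) \<noteq> 0"
    using cos_gt_zero_pi by fastforce
  then have "tan (\<theta> - r) = (\<kappa> * tan r - tan r) / (1 + \<kappa> * tan r * tan r)"
    using \<theta> cr by (simp add: tan_diff)
  also have "\<dots> = (\<kappa> - 1) * sin s * cos s / ((cos s)\<^sup>2 + \<kappa> * (sin s)\<^sup>2)"
  proof -
    have "1 + \<kappa> * tan s * tan s = ((cos s)\<^sup>2 + \<kappa> * (sin s)\<^sup>2) / (cos s)\<^sup>2"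
      using False by (simp add: tan_def field_simps power2_eq_square)
    moreover have "\<kappa> * tan s - tan s = (\<kappa> - 1) * sin s * cos s / (cos s)\<^sup>2"
      using False by (simp add: tan_def field_simps power2_eq_square)
    ultimately show ?thesis
      using False by (simp add: tan[symmetric])
  qed
  finally have "\<theta> - r = arctan ((\<kappa> - 1) * sin s * cos s / ((cos s)\<^sup>2 + \<kappa> * (sin s)\<^sup>2))"
    using arctan_tan[OF b] by simp
  moreover have "arctan_tan \<kappa> s = \<theta> + of_int k * pi"
    using False by (simp add: arctan_tan_def tan \<theta>_def k_def)
  ultimately show ?thesis
    using r_def by linarith
qed

text \<open>Away from the zeros of \<open>cos\<close> this is the chain rule, cleared of cos^2.
  Differentiating the formula of \<open>arctan_tan_eq\<close> instead covers the junction points as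
  well.\<close>

lemma DERIV_arctan_tan:
  assumes "\<kappa> > 0"
  shows "(arctan_tan \<kappa> has_real_derivative \<kappa> / ((cos s)\<^sup>2 + \<kappa>\<^sup>2 * (sin s)\<^sup>2)) (at s)"
proof -
  define S C where "S = sin s" and "C = cos s"
  have SC: "C\<^sup>2 = 1 - S\<^sup>2" by (simp add: S_def C_def cos_squared_eq)
  define M where "M = C\<^sup>2 + \<kappa> * S\<^sup>2"
  define Q where "Q = C\<^sup>2 + \<kappa>\<^sup>2 * S\<^sup>2"
  define R' where "R' = (\<kappa> - 1) * (C\<^sup>2 - \<kappa> * S\<^sup>2) / M\<^sup>2"
  have M: "M > 0" and Q: "Q > 0"
    using cos_sin_form_pos assms by (auto simp: M_def Q_def S_def C_def)
  \<comment> \<open>The left side equals (C^2 + \<kappa>^2 S^2)(C^2 + S^2), an instance of the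
    two-square identity. It turns the denominator produced by arctan into \<open>Q\<close>.\<close>
  have Q_eq: "M\<^sup>2 + ((\<kappa> - 1) * S * C)\<^sup>2 = Q"
    unfolding M_def Q_def power_mult_distrib SC by (simp add: power2_eq_square algebra_simps)
  have "((\<lambda>s. (\<kappa> - 1) * sin s * cos s / ((cos s)\<^sup>2 + \<kappa> * (sin s)\<^sup>2)) has_real_derivative
      (((\<kappa> - 1) * (C\<^sup>2 - S\<^sup>2)) * M - ((\<kappa> - 1) * S * C) * (2 * (\<kappa> - 1) * S * C)) / (M * M)) (at s)"
    using M unfolding M_def S_def C_def
    by (intro DERIV_divide) (auto intro!: derivative_eq_intros simp: power2_eq_square algebra_simps)
  also have "(((\<kappa> - 1) * (C\<^sup>2 - S\<^sup>2)) * M - ((\<kappa> - 1) * S * C) * (2 * (\<kappa> - 1) * S * C)) / (M * M) = R'"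
    unfolding R'_def power2_eq_square[of M, symmetric]
    by (rule arg_cong[where f = "\<lambda>x. x / M\<^sup>2"])
      (use SC in \<open>unfold M_def, algebra\<close>)
  finally have "((\<lambda>s. s + arctan ((\<kappa> - 1) * sin s * cos s / ((cos s)\<^sup>2 + \<kappa> * (sin s)\<^sup>2))) has_real_derivative
      1 + inverse (1 + ((\<kappa> - 1) * S * C / M)\<^sup>2) * R') (at s)"
    unfolding M_def S_def C_def
    by (intro DERIV_add DERIV_ident DERIV_chain2[OF DERIV_arctan])
  also have "1 + inverse (1 + ((\<kappa> - 1) * S * C / M)\<^sup>2) * R' = 1 + (\<kappa> - 1) * (C\<^sup>2 - \<kappa> * S\<^sup>2) / Q"
  proof -
    have "1 + ((\<kappa> - 1) * S * C / M)\<^sup>2 = Q / M\<^sup>2"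
      using M by (simp add: power_divide add_divide_distrib Q_eq[symmetric])
    then show ?thesis
      using M by (simp add: R'_def)
  qed
  also have "\<dots> = \<kappa> / Q"
    using Q by (simp add: divide_simps) (use SC in \<open>unfold Q_def, algebra\<close>)
  finally show ?thesis
    by (simp add: arctan_tan_eq[OF assms, abs_def] Q_def S_def C_def)
qed

section \<open>The explicit orbits and their differential equations\<close>

text \<open>The relation \<open>\<omega>_sq\<close> is \<omega>^2 = \<phi>^2 + 1 + x_3'^2 after x_3'
  is eliminated through the eccentricity. No assumption constrains \<open>t0\<close>, so the
  predicate \<open>goedel_orbit\<close> takes only the other three parameters.\<close>

locale goedel_orbit =
  fixes \<phi> q \<omega> t0 :: real
  assumes \<phi>_pos: "\<phi> > 0" and q_nonneg: "0 \<le> q" and q_less_1: "q < 1" and \<omega>_pos: "\<omega> > 0"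
    and \<omega>_sq: "\<omega>\<^sup>2 = 2 * \<phi>\<^sup>2 * (1 - q\<^sup>2)"
begin

text \<open>Up to the constant factor 2 / (1 + q), this is the expression (1 + \<alpha>) + (1 -
  \<alpha>) cos \<tau> of form (ii).\<close>

definition N where "N t = 1 + q * cos (\<omega> * (t - t0))"

definition X0 where "X0 t = - \<phi> * t + 2 * sqrt 2 *
  (arctan_tan (sqrt ((1 - q) / (1 + q))) (\<omega> * (t - t0) / 2)
   - arctan_tan (sqrt ((1 - q) / (1 + q))) (- \<omega> * t0 / 2))"

definition X1 where "X1 t = ln (N t / N 0)"

definition X2 where "X2 t = 2 * \<phi> * q / \<omega> * N 0 *
  (sin (\<omega> * (t - t0)) / N t - sin (- \<omega> * t0) / N 0)"

definition V0 where "V0 t = - \<phi> + 2 * \<phi> * (1 - q\<^sup>2) / N t"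

definition V1 where "V1 t = - q * \<omega> * sin (\<omega> * (t - t0)) / N t"

text \<open>Defined from \<open>V0\<close> so that the e_0-component equals \<phi> by construction;
  \<open>V2_eq\<close> gives the explicit expression.\<close>

definition V2 where "V2 t = (\<phi> - V0 t) * exp (- X1 t)"

lemma N_pos: "N t > 0"
proof -
  have "\<bar>q * cos (\<omega> * (t - t0))\<bar> \<le> q"
    using q_nonneg by (simp add: abs_mult mult_left_le)
  then show ?thesis
    using q_less_1 by (simp add: N_def)
qed

lemma X_at_0: "X0 0 = 0" "X1 0 = 0" "X2 0 = 0"
  using N_pos[of 0] by (auto simp: X0_def X1_def X2_def)

lemma exp_X1: "exp (X1 t) = N t / N 0"
  using N_pos by (simp add: X1_def)

lemma DERIV_N: "(N has_real_derivative - q * \<omega> * sin (\<omega> * (t - t0))) (at t)"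
  unfolding N_def by (auto intro!: derivative_eq_intros)

lemma DERIV_X1: "(X1 has_real_derivative V1 t) (at t)"
  unfolding X1_def V1_def
  using N_pos[of t] N_pos[of 0]
  by (auto intro!: derivative_eq_intros DERIV_N simp: field_simps)

lemma V2_eq: "V2 t = 2 * \<phi> * q * N 0 * (cos (\<omega> * (t - t0)) + q) / (N t)\<^sup>2"
proof -
  have "\<phi> - V0 t = 2 * \<phi> * q * (cos (\<omega> * (t - t0)) + q) / N t"
    using N_pos[of t] by (simp add: V0_def divide_simps)
      (simp add: N_def power2_eq_square algebra_simps)
  then show ?thesis
    by (simp add: V2_def exp_minus exp_X1 power2_eq_square)
qed

lemma DERIV_X2: "(X2 has_real_derivative V2 t) (at t)"
proof -
  have "((\<lambda>t. sin (\<omega> * (t - t0)) / N t) has_real_derivative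
      (cos (\<omega> * (t - t0)) * \<omega> * N t - sin (\<omega> * (t - t0)) * (- q * \<omega> * sin (\<omega> * (t - t0)))) / (N t * N t)) (at t)"
    using N_pos[of t] by (intro DERIV_divide DERIV_N) (auto intro!: derivative_eq_intros)
  also have "cos (\<omega> * (t - t0)) * \<omega> * N t - sin (\<omega> * (t - t0)) * (- q * \<omega> * sin (\<omega> * (t - t0)))
      = \<omega> * (cos (\<omega> * (t - t0)) + q)"
    unfolding N_def using sin_cos_squared_add[of "\<omega> * (t - t0)"] by algebra
  finally have "(X2 has_real_derivative 2 * \<phi> * q / \<omega> * N 0 *
      (\<omega> * (cos (\<omega> * (t - t0)) + q) / (N t * N t) - 0)) (at t)"
    unfolding X2_def by (intro DERIV_cmult DERIV_diff DERIV_const)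
  then show ?thesis
    using \<omega>_pos by (simp add: V2_eq power2_eq_square mult.assoc)
qed

text \<open>The half-angle formula turns the denominator of \<open>DERIV_arctan_tan\<close> into
  \<open>N t / (1 + q)\<close>, provided that \<kappa>^2 = (1 - q) / (1 + q). This is the origin of
  \<alpha>.\<close>

lemma DERIV_X0: "(X0 has_real_derivative V0 t) (at t)"
proof -
  define \<kappa> where "\<kappa> = sqrt ((1 - q) / (1 + q))"
  define h where "h = \<omega> * (t - t0) / 2"
  have \<kappa>: "\<kappa> > 0" "\<kappa>\<^sup>2 = (1 - q) / (1 + q)"
    using q_nonneg q_less_1 by (auto simp: \<kappa>_def)
  have "(1 + q) * ((cos h)\<^sup>2 + \<kappa>\<^sup>2 * (sin h)\<^sup>2) = (1 + q) * (cos h)\<^sup>2 + (1 - q) * (sin h)\<^sup>2"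
    using q_nonneg by (simp add: \<kappa>(2) divide_simps)
  also have "\<dots> = 1 + q * cos (2 * h)"
    unfolding cos_double using sin_cos_squared_add[of h] by algebra
  finally have "(1 + q) * ((cos h)\<^sup>2 + \<kappa>\<^sup>2 * (sin h)\<^sup>2) = N t"
    by (simp add: N_def h_def)
  then have den: "(cos h)\<^sup>2 + \<kappa>\<^sup>2 * (sin h)\<^sup>2 = N t / (1 + q)"
    using q_nonneg by (simp add: field_simps)
  \<comment> \<open>This equality of positive numbers, checked on squares by
    \<open>\<omega>_sq\<close>, is why the arctangent carries the pure number 2 sqrt 2 as its
    coefficient.\<close>
  have "(sqrt 2 * \<omega> * \<kappa> * (1 + q))\<^sup>2 = 2 * \<omega>\<^sup>2 * \<kappa>\<^sup>2 * (1 + q)\<^sup>2"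
    by (simp add: power_mult_distrib)
  also have "\<dots> = (2 * \<phi> * (1 - q\<^sup>2))\<^sup>2"
    using q_nonneg by (simp add: \<omega>_sq \<kappa>(2) divide_simps) algebra
  finally have coef: "sqrt 2 * \<omega> * \<kappa> * (1 + q) = 2 * \<phi> * (1 - q\<^sup>2)"
    by (rule power2_eq_imp_eq)
      (use \<phi>_pos q_nonneg q_less_1 \<omega>_pos \<kappa> in \<open>auto simp: power_le_one\<close>)
  have "((\<lambda>t. arctan_tan \<kappa> (\<omega> * (t - t0) / 2)) has_real_derivative
      \<kappa> / ((cos h)\<^sup>2 + \<kappa>\<^sup>2 * (sin h)\<^sup>2) * (\<omega> / 2)) (at t)"
    unfolding h_def
    by (rule DERIV_chain2[OF DERIV_arctan_tan[OF \<kappa>(1)]]) (auto intro!: derivative_eq_intros)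
  then have "(X0 has_real_derivative - \<phi> + 2 * sqrt 2 *
      (\<kappa> / ((cos h)\<^sup>2 + \<kappa>\<^sup>2 * (sin h)\<^sup>2) * (\<omega> / 2) - 0)) (at t)"
    unfolding X0_def \<kappa>_def[symmetric]
    by (intro DERIV_add DERIV_diff DERIV_cmult DERIV_const DERIV_cmult_Id)
  also have "- \<phi> + 2 * sqrt 2 * (\<kappa> / ((cos h)\<^sup>2 + \<kappa>\<^sup>2 * (sin h)\<^sup>2) * (\<omega> / 2) - 0) = V0 t"
    unfolding den V0_def coef[symmetric] by simp
  finally show ?thesis .
qed

lemma e0_V: "V0 t + exp (X1 t) * V2 t = \<phi>"
  by (simp add: V2_def mult.left_commute[of "exp _"] exp_minus)

text \<open>This and the next two lemmas are rows 0, 1 and 2 of the geodesic equation. Here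
  \<open>V0 t + \<phi>\<close> is a multiple of 1 / N, and \<open>V1\<close> is the logarithmic
  derivative of \<open>N\<close>.\<close>

lemma DERIV_V0: "(V0 has_real_derivative - (2 * V0 t * V1 t + exp (X1 t) * V1 t * V2 t)) (at t)"
proof -
  have "(V0 has_real_derivative
      2 * \<phi> * (1 - q\<^sup>2) * (q * \<omega> * sin (\<omega> * (t - t0))) / (N t)\<^sup>2) (at t)"
    unfolding V0_def using N_pos[of t]
    by (auto intro!: derivative_eq_intros DERIV_N simp: power2_eq_square)
  also have "2 * \<phi> * (1 - q\<^sup>2) * (q * \<omega> * sin (\<omega> * (t - t0))) / (N t)\<^sup>2 = - V1 t * (V0 t + \<phi>)"
    by (simp add: V0_def V1_def power2_eq_square)
  also have "\<dots> = - (2 * V0 t * V1 t + exp (X1 t) * V1 t * V2 t)"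
    by (simp add: V2_def exp_minus algebra_simps)
  finally show ?thesis .
qed

lemma DERIV_V1:
  "(V1 has_real_derivative - (exp (X1 t) * V0 t * V2 t + exp (2 * X1 t) * (V2 t)\<^sup>2 / 2)) (at t)"
proof -
  define c where "c = cos (\<omega> * (t - t0))"
  have "(V1 has_real_derivative
      (- q * \<omega> * (c * \<omega>) * N t - (- q * \<omega> * sin (\<omega> * (t - t0))) * (- q * \<omega> * sin (\<omega> * (t - t0))))
        / (N t * N t)) (at t)"
    unfolding V1_def c_def using N_pos[of t]
    by (intro DERIV_divide DERIV_N) (auto intro!: derivative_eq_intros)
  also have "- q * \<omega> * (c * \<omega>) * N t - (- q * \<omega> * sin (\<omega> * (t - t0))) * (- q * \<omega> * sin (\<omega> * (t - t0)))
      = - q * (c + q) * \<omega>\<^sup>2"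
    unfolding N_def c_def using sin_cos_squared_add[of "\<omega> * (t - t0)"] by algebra
  \<comment> \<open>Inserting \<open>\<omega>_sq\<close> splits the expression into two factors, E
    V2 and V0 + \<phi> = 2 V0 + E V2.\<close>
  also have "- q * (c + q) * \<omega>\<^sup>2 / (N t * N t) = - ((2 * \<phi> * q * (c + q) / N t) * (2 * \<phi> * (1 - q\<^sup>2) / N t) / 2)"
    unfolding \<omega>_sq by (simp add: power2_eq_square)
  also have "2 * \<phi> * q * (c + q) / N t = exp (X1 t) * V2 t"
    using N_pos[of 0] by (simp add: V2_eq exp_X1 c_def power2_eq_square)
  also have "2 * \<phi> * (1 - q\<^sup>2) / N t = 2 * V0 t + exp (X1 t) * V2 t"
    using e0_V[of t] by (simp add: V0_def)
  also have "exp (X1 t) * V2 t * (2 * V0 t + exp (X1 t) * V2 t) / 2 =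
      exp (X1 t) * V0 t * V2 t + exp (2 * X1 t) * (V2 t)\<^sup>2 / 2"
    by (simp add: exp_double power2_eq_square field_simps)
  finally show ?thesis .
qed

lemma DERIV_V2: "(V2 has_real_derivative 2 * exp (- X1 t) * V0 t * V1 t) (at t)"
proof -
  have "(V2 has_real_derivative
      (0 - - (2 * V0 t * V1 t + exp (X1 t) * V1 t * V2 t)) * exp (- X1 t)
        + (exp (- X1 t) * - V1 t) * (\<phi> - V0 t)) (at t)"
    unfolding V2_def[abs_def]
    by (intro DERIV_mult DERIV_diff DERIV_const DERIV_V0[unfolded V2_def]
        DERIV_chain2[OF DERIV_exp] DERIV_minus DERIV_X1)
  also have "(0 - - (2 * V0 t * V1 t + exp (X1 t) * V1 t * V2 t)) * exp (- X1 t)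
        + (exp (- X1 t) * - V1 t) * (\<phi> - V0 t) = 2 * exp (- X1 t) * V0 t * V1 t"
    by (simp add: V2_def exp_minus field_simps)
  finally show ?thesis .
qed

text \<open>The squared speed in the e_1 and e_2' directions is constant; it is the spatial part of
  the unit speed condition, apart from x_3.\<close>

lemma energy_V: "(exp (X1 t) * V2 t)\<^sup>2 / 2 + (V1 t)\<^sup>2 = 2 * \<phi>\<^sup>2 * q\<^sup>2"
proof -
  define c s where "c = cos (\<omega> * (t - t0))" and "s = sin (\<omega> * (t - t0))"
  have "exp (X1 t) * V2 t = 2 * \<phi> * q * (c + q) / N t"
    using N_pos[of 0] by (simp add: V2_eq exp_X1 c_def power2_eq_square)
  then have "(exp (X1 t) * V2 t)\<^sup>2 / 2 + (V1 t)\<^sup>2 =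
      ((2 * \<phi> * q * (c + q))\<^sup>2 / 2 + \<omega>\<^sup>2 * (q * s)\<^sup>2) / (N t)\<^sup>2"
    by (simp add: V1_def s_def power_mult_distrib power_divide add_divide_distrib)
  \<comment> \<open>After division by 2 \<phi>^2 q^2 this is (c + q)^2 + (1 - q^2) s^2 = (1 + q
    c)^2.\<close>
  also have "(2 * \<phi> * q * (c + q))\<^sup>2 / 2 + \<omega>\<^sup>2 * (q * s)\<^sup>2 = 2 * \<phi>\<^sup>2 * q\<^sup>2 * (N t)\<^sup>2"
    using sin_cos_squared_add[of "\<omega> * (t - t0)"]
    unfolding \<omega>_sq N_def c_def[symmetric] s_def[symmetric] by (simp add: field_simps) algebra
  finally show ?thesis
    using N_pos[of t] by simp
qed

end

section \<open>Integration on an interval, and the harmonic oscillator\<close>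

lemma DERIV_zero_on_interval_constant:
  fixes f :: "real \<Rightarrow> real"
  assumes "is_interval I" "a \<in> I" "b \<in> I"
    and "\<And>t. t \<in> I \<Longrightarrow> (f has_real_derivative 0) (at t)"
  shows "f b = f a"
proof -
  have "\<exists>c. \<forall>t\<in>I. f t = c"
    using assms(1,4)
    by (intro has_field_derivative_zero_constant)
      (auto simp: is_interval_convex_1 intro: has_field_derivative_at_within)
  then show ?thesis
    using assms(2,3) by auto
qed

lemma same_DERIV_on_interval_eq:
  fixes f g :: "real \<Rightarrow> real"
  assumes "is_interval I" "a \<in> I" "f a = g a"
    and "\<And>t. t \<in> I \<Longrightarrow> (f has_real_derivative d t) (at t)"
    and "\<And>t. t \<in> I \<Longrightarrow> (g has_real_derivative d t) (at t)"
    and "b \<in> I"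
  shows "f b = g b"
proof -
  have "((\<lambda>t. f t - g t) has_real_derivative 0) (at t)" if "t \<in> I" for t
    using DERIV_diff[OF assms(4,5)[OF that]] by simp
  from DERIV_zero_on_interval_constant[OF assms(1,2,6) this] assms(3) show ?thesis
    by simp
qed

text \<open>\<open>P\<close> and \<open>Q\<close> are the coordinates of the phase point (v - h, w /
  \<omega>) rotated back by the angle \<omega> t. The rotation undoes the motion, so both are
  constant.\<close>

lemma harmonic_oscillator_unique:
  fixes v w :: "real \<Rightarrow> real"
  assumes I: "is_interval I" "0 \<in> I" "t \<in> I" and "\<omega> \<noteq> 0"
    and v: "\<And>t. t \<in> I \<Longrightarrow> (v has_real_derivative w t) (at t)"
    and w: "\<And>t. t \<in> I \<Longrightarrow> (w has_real_derivative - \<omega>\<^sup>2 * (v t - h)) (at t)"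
  shows "v t = h + (v 0 - h) * cos (\<omega> * t) + w 0 / \<omega> * sin (\<omega> * t)"
proof -
  define P where "P t = (v t - h) * cos (\<omega> * t) - w t / \<omega> * sin (\<omega> * t)" for t
  define Q where "Q t = (v t - h) * sin (\<omega> * t) + w t / \<omega> * cos (\<omega> * t)" for t
  have P: "(P has_real_derivative 0) (at t)" and Q: "(Q has_real_derivative 0) (at t)"
    if "t \<in> I" for t
    unfolding P_def Q_def using \<open>\<omega> \<noteq> 0\<close>
    by (auto intro!: derivative_eq_intros v[OF that] w[OF that] simp: field_simps power2_eq_square)
  have "P t = P 0" "Q t = Q 0"
    by (rule DERIV_zero_on_interval_constant[OF I P] DERIV_zero_on_interval_constant[OF I Q]; assumption)+
  then have PQ: "P t = v 0 - h" "Q t = w 0 / \<omega>"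
    by (simp_all add: P_def Q_def)
  have "v t - h = P t * cos (\<omega> * t) + Q t * sin (\<omega> * t)"
    unfolding P_def Q_def using sin_cos_squared_add[of "\<omega> * t"] by algebra
  then show ?thesis
    by (simp add: PQ)
qed

lemma polar_nonneg_radius:
  fixes x y r :: real
  assumes "x\<^sup>2 + y\<^sup>2 = r\<^sup>2" "r \<ge> 0"
  obtains a where "x = r * cos a" "y = r * sin a"
proof (cases "r = 0")
  case True
  then show ?thesis
    using assms that by (auto simp: sum_power2_eq_zero_iff)
next
  case False
  then have "(x / r)\<^sup>2 + (y / r)\<^sup>2 = 1"
    using assms by (simp add: power_divide add_divide_distrib[symmetric])
  then obtain a where "x / r = cos a" "y / r = sin a"
    using sincos_total_2pi by blast
  then show ?thesis
    using that[of a] False by (simp add: field_simps)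
qed

section \<open>Every unit speed geodesic is an explicit orbit\<close>

text \<open>The conservation laws reduce the system to a linear oscillator for E, solved on the
  whole interval; matching its phase and amplitude with \<open>N\<close> gives x_1, and the other
  coordinates follow from equal derivatives and equal initial values.\<close>

lemma goedel_geodesic_normal_form:
  fixes \<gamma> :: "real \<Rightarrow> real^4" and I :: "real set"
  assumes I: "is_interval I" "0 \<in> I"
    and geod: "geodesic_on goedel_metric I \<gamma>"
    and unit: "\<forall>t\<in>I. metric_form goedel_metric (\<gamma> t) (velocity \<gamma> t) (velocity \<gamma> t) = 1"
    and future: "future_directed_on I \<gamma>"
    and start: "\<gamma> 0 = 0"
  obtains \<phi> q \<omega> t0 \<phi>3 where "goedel_orbit \<phi> q \<omega>" "1 + \<phi>3\<^sup>2 = \<phi>\<^sup>2 * (1 - 2 * q\<^sup>2)"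
    "\<forall>t\<in>I. e0_component (\<gamma> t) (velocity \<gamma> t) = \<phi>"
    "\<forall>t\<in>I. \<gamma> t $ 0 = goedel_orbit.X0 \<phi> q \<omega> t0 t \<and> \<gamma> t $ 1 = goedel_orbit.X1 q \<omega> t0 t \<and>
      \<gamma> t $ 2 = goedel_orbit.X2 \<phi> q \<omega> t0 t \<and> \<gamma> t $ 3 = \<phi>3 * t"
proof -
  define V where "V k t = velocity \<gamma> t $ k" for k t
  define E where "E t = exp (\<gamma> t $ 1)" for t
  have E_pos: "E t > 0" and E_start: "E 0 = 1" for t
    by (simp_all add: E_def start)
  have DX: "((\<lambda>t. \<gamma> t $ k) has_real_derivative V k t) (at t)" if "t \<in> I" for k t
    unfolding V_def using geodesic_onD(1)[OF geod that] .
  have DE: "(E has_real_derivative E t * V 1 t) (at t)" if "t \<in> I" for t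
    unfolding E_def by (rule DERIV_fun_exp[OF DX[OF that]])
  have DV0: "(V 0 has_real_derivative - (2 * V 0 t * V 1 t + E t * V 1 t * V 2 t)) (at t)"
    and DV1: "(V 1 has_real_derivative - (E t * V 0 t * V 2 t + (E t)\<^sup>2 * (V 2 t)\<^sup>2 / 2)) (at t)"
    and DV2: "(V 2 has_real_derivative 2 * V 0 t * V 1 t / E t) (at t)"
    and DV3: "(V 3 has_real_derivative 0) (at t)" if "t \<in> I" for t
  proof -
    note acc = geodesic_onD(2)[OF geod that]
    show "(V 0 has_real_derivative - (2 * V 0 t * V 1 t + E t * V 1 t * V 2 t)) (at t)"
      using acc[of 0] by (simp only: christoffel_sum_goedel V_def[abs_def] E_def)
    show "(V 1 has_real_derivative - (E t * V 0 t * V 2 t + (E t)\<^sup>2 * (V 2 t)\<^sup>2 / 2)) (at t)"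
      using acc[of 1] by (simp only: christoffel_sum_goedel V_def[abs_def] E_def exp_double)
    show "(V 2 has_real_derivative 2 * V 0 t * V 1 t / E t) (at t)"
      using acc[of 2] unfolding christoffel_sum_goedel
      by (simp add: V_def[abs_def] E_def exp_minus divide_inverse mult_ac)
    show "(V 3 has_real_derivative 0) (at t)"
      using acc[of 3] by (simp only: christoffel_sum_goedel V_def[abs_def] minus_zero)
  qed

  \<comment> \<open>The conserved quantities are named by their values at time 0, where
    \<open>E 0 = 1\<close>.\<close>
  define \<phi> where "\<phi> = V 0 0 + V 2 0"
  define c where "c = V 0 0 + V 2 0 / 2"
  define \<phi>3 where "\<phi>3 = V 3 0"
  have phi: "V 0 t + E t * V 2 t = \<phi>" if "t \<in> I" for t
  proof -
    have "((\<lambda>t. V 0 t + E t * V 2 t) has_real_derivative 0) (at t)" if "t \<in> I" for t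
      using E_pos[of t]
      by (auto intro!: derivative_eq_intros DV0[OF that] DV2[OF that] DE[OF that])
    from DERIV_zero_on_interval_constant[OF I that this] show ?thesis
      by (simp add: E_start \<phi>_def)
  qed
  have c: "E t * V 0 t + (E t)\<^sup>2 * V 2 t / 2 = c" if "t \<in> I" for t
  proof -
    have "((\<lambda>t. E t * V 0 t + (E t)\<^sup>2 * V 2 t / 2) has_real_derivative 0) (at t)" if "t \<in> I" for t
      using E_pos[of t]
      by (auto intro!: derivative_eq_intros DV0[OF that] DV2[OF that] DE[OF that]
          simp: field_simps power2_eq_square)
    from DERIV_zero_on_interval_constant[OF I that this] show ?thesis
      by (simp add: E_start c_def)
  qed
  have phi3: "V 3 t = \<phi>3" if "t \<in> I" for t
    using DERIV_zero_on_interval_constant[OF I that DV3] by (simp add: \<phi>3_def)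
  have e0: "e0_component (\<gamma> t) (velocity \<gamma> t) = \<phi>" if "t \<in> I" for t
    using phi[OF that] by (simp add: e0_component_def E_def V_def)
  have phi_pos: "\<phi> > 0"
    using future I e0 by (auto simp: future_directed_on_def)
  have EV2: "E t * V 2 t = 2 * \<phi> - 2 * c / E t" if "t \<in> I" for t
    unfolding phi[OF that, symmetric] c[OF that, symmetric] using E_pos[of t]
    by (simp add: field_simps power2_eq_square)
  \<comment> \<open>By unit speed, \<open>s2\<close> is the squared speed in the e_1 and e_2'
    directions.\<close>
  define s2 where "s2 = \<phi>\<^sup>2 - 1 - \<phi>3\<^sup>2"
  have energy: "(V 1 t)\<^sup>2 = s2 - 2 * (\<phi> - c / E t)\<^sup>2" if "t \<in> I" for t
  proof -
    have "\<phi>\<^sup>2 - (E t * V 2 t)\<^sup>2 / 2 - (V 1 t)\<^sup>2 - (V 3 t)\<^sup>2 = 1"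
      using bspec[OF unit that] e0[OF that] by (simp add: metric_form_goedel E_def V_def)
    moreover have "E t * V 2 t = 2 * (\<phi> - c / E t)"
      by (simp add: EV2[OF that] right_diff_distrib)
    moreover have "(2 * z)\<^sup>2 / 2 = 2 * z\<^sup>2" for z :: real
      by (simp add: power_mult_distrib)
    ultimately have "\<phi>\<^sup>2 - 2 * (\<phi> - c / E t)\<^sup>2 - (V 1 t)\<^sup>2 - \<phi>3\<^sup>2 = 1"
      by (simp only: phi3[OF that])
    then show ?thesis
      unfolding s2_def by linarith
  qed

  \<comment> \<open>The eccentricity solves s2 = 2 \<phi>^2 q^2, and \<omega>^2 = 2 \<phi>^2 - s2 is
    \<phi>^2 + 1 + \<phi>3^2.\<close>
  define q where "q = sqrt (s2 / (2 * \<phi>\<^sup>2))"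
  define \<omega> where "\<omega> = sqrt (2 * \<phi>\<^sup>2 - s2)"
  have s2_nonneg: "s2 \<ge> 0"
    using energy[OF I(2)] zero_le_power2[of "V 1 0"] zero_le_power2[of "\<phi> - c / E 0"] by linarith
  have s2_less: "s2 < \<phi>\<^sup>2"
    unfolding s2_def using zero_le_power2[of \<phi>3] by linarith
  have q2: "q\<^sup>2 = s2 / (2 * \<phi>\<^sup>2)"
    using s2_nonneg by (simp add: q_def)
  have omega2: "\<omega>\<^sup>2 = 2 * \<phi>\<^sup>2 - s2"
    using s2_less s2_nonneg by (simp add: \<omega>_def)
  have q_nonneg: "q \<ge> 0"
    using s2_nonneg by (simp add: q_def)
  have "q\<^sup>2 < 1\<^sup>2"
    unfolding q2 using s2_less s2_nonneg phi_pos by simp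
  then have q_less_1: "q < 1"
    by (rule power2_less_imp_less) simp
  have omega_pos: "\<omega> > 0"
    using s2_less s2_nonneg by (simp add: \<omega>_def)
  have orbit: "goedel_orbit \<phi> q \<omega>"
    using phi_pos q_nonneg q_less_1 omega_pos
    by unfold_locales (auto simp: omega2 q2 field_simps)

  \<comment> \<open>The equilibrium of E'' = - \<omega>^2 E + 2 c \<phi>.\<close>
  define h where "h = 2 * c * \<phi> / \<omega>\<^sup>2"
  have E_sol: "E t = h + (1 - h) * cos (\<omega> * t) + V 1 0 / \<omega> * sin (\<omega> * t)" if "t \<in> I" for t
  proof -
    \<comment> \<open>The product rule yields E x_1'^2; replacing x_1'^2 by the energy law makes the
      terms in c^2 / E cancel, and the equation becomes linear.\<close>
    have "((\<lambda>t. E t * V 1 t) has_real_derivative - \<omega>\<^sup>2 * (E t - h)) (at t)" if "t \<in> I" for t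
    proof -
      have "((\<lambda>t. E t * V 1 t) has_real_derivative
          E t * V 1 t * V 1 t + - (E t * V 0 t * V 2 t + (E t)\<^sup>2 * (V 2 t)\<^sup>2 / 2) * E t) (at t)"
        by (intro DERIV_mult DE DV1 that)
      also have "E t * V 1 t * V 1 t + - (E t * V 0 t * V 2 t + (E t)\<^sup>2 * (V 2 t)\<^sup>2 / 2) * E t
          = E t * (V 1 t)\<^sup>2 - (E t * V 0 t + (E t)\<^sup>2 * V 2 t / 2) * (E t * V 2 t)"
        by (simp add: power2_eq_square algebra_simps)
      also have "\<dots> = E t * (s2 - 2 * (\<phi> - c / E t)\<^sup>2) - c * (2 * \<phi> - 2 * c / E t)"
        by (simp only: energy[OF that] c[OF that] EV2[OF that])
      also have "\<dots> = - \<omega>\<^sup>2 * E t + 2 * c * \<phi>"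
        unfolding omega2 using E_pos[of t] by (simp add: field_simps power2_eq_square)
      also have "\<dots> = - \<omega>\<^sup>2 * (E t - h)"
        using omega_pos by (simp add: h_def field_simps)
      finally show ?thesis .
    qed
    from harmonic_oscillator_unique[OF I that _ DE this] omega_pos show ?thesis
      by (simp add: E_start)
  qed
  \<comment> \<open>Otherwise the energy law at time 0 would force s2 \<ge> 2 \<phi>^2. Positivity
    of \<open>c\<close> makes \<open>h\<close>, and with it the amplitude h q, nonnegative.\<close>
  have c_pos: "c > 0"
  proof (rule ccontr)
    assume "\<not> c > 0"
    then have "\<phi>\<^sup>2 \<le> (\<phi> - c)\<^sup>2"
      using phi_pos by (intro power_mono) auto
    moreover have "2 * (\<phi> - c)\<^sup>2 \<le> s2"
      using energy[OF I(2)] zero_le_power2[of "V 1 0"] by (simp add: E_start)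
    ultimately show False
      using s2_less zero_le_power2[of \<phi>] by linarith
  qed
  \<comment> \<open>The energy law at time 0 says that the amplitude of E is q times its mean value
    \<open>h\<close>, which is what E = h N demands.\<close>
  have amplitude: "(1 - h)\<^sup>2 + (V 1 0 / \<omega>)\<^sup>2 = (h * q)\<^sup>2"
  proof -
    have "(V 1 0)\<^sup>2 = - \<omega>\<^sup>2 + 4 * \<phi> * c - 2 * c\<^sup>2"
      unfolding omega2 using energy[OF I(2)]
      by (simp add: E_start power2_eq_square algebra_simps)
    moreover have "4 * \<phi> * c = 2 * h * \<omega>\<^sup>2"
      using omega_pos by (simp add: h_def)
    ultimately have "(1 - h)\<^sup>2 + (V 1 0 / \<omega>)\<^sup>2 = h\<^sup>2 - 2 * c\<^sup>2 / \<omega>\<^sup>2"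
      using omega_pos by (simp add: power_divide field_simps) (simp add: power2_eq_square algebra_simps)
    also have "2 * c\<^sup>2 / \<omega>\<^sup>2 = h\<^sup>2 * (\<omega>\<^sup>2 / (2 * \<phi>\<^sup>2))"
      using omega_pos phi_pos by (simp add: h_def power2_eq_square)
    also have "h\<^sup>2 - h\<^sup>2 * (\<omega>\<^sup>2 / (2 * \<phi>\<^sup>2)) = (h * q)\<^sup>2"
      using phi_pos by (simp add: omega2 power_mult_distrib q2 field_simps)
    finally show ?thesis .
  qed
  have "h * q \<ge> 0"
    using c_pos phi_pos q_nonneg by (simp add: h_def)
  then obtain a where a: "1 - h = h * q * cos a" "V 1 0 / \<omega> = h * q * sin a"
    using polar_nonneg_radius[OF amplitude] by blast
  \<comment> \<open>The phase of the oscillation, converted into a time shift.\<close>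
  define t0 where "t0 = a / \<omega>"
  interpret goedel_orbit \<phi> q \<omega> t0
    by (rule orbit)
  have "E t = h * N t" if "t \<in> I" for t
  proof -
    have "\<omega> * (t - t0) = \<omega> * t - a"
      using omega_pos by (simp add: t0_def field_simps)
    then show ?thesis
      unfolding E_sol[OF that] a N_def by (simp add: cos_diff algebra_simps)
  qed
  moreover from this[OF I(2)] have hN: "h * N 0 = 1"
    by (simp add: E_start)
  ultimately have E_eq: "E t = N t / N 0" if "t \<in> I" for t
    using that N_pos[of 0] by (simp add: field_simps)
  have "\<gamma> t $ 1 = ln (E t)" for t
    by (simp add: E_def)
  then have X1: "\<gamma> t $ 1 = X1 t" if "t \<in> I" for t
    by (simp add: E_eq that X1_def)
  \<comment> \<open>With \<open>c\<close> expressed through the orbit parameters, the formula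
    \<open>EV2\<close> for E x_2' becomes \<phi> - V0.\<close>
  have c_eq: "c = \<phi> * (1 - q\<^sup>2) / N 0"
  proof -
    have "2 * c * \<phi> * N 0 = \<omega>\<^sup>2"
      using hN omega_pos by (simp add: h_def field_simps)
    then have "c * N 0 = \<phi> * (1 - q\<^sup>2)"
      using phi_pos unfolding \<omega>_sq by (simp add: power2_eq_square)
    then show ?thesis
      using N_pos[of 0] by (simp add: field_simps)
  qed
  have EV2': "E t * V 2 t = \<phi> - V0 t" if "t \<in> I" for t
    unfolding EV2[OF that] using N_pos[of 0] by (simp add: E_eq[OF that] c_eq V0_def)
  have V0: "V 0 t = V0 t" if "t \<in> I" for t
    using phi[OF that] EV2'[OF that] by simp
  have V2: "V 2 t = V2 t" if "t \<in> I" for t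
    using EV2'[OF that] E_pos[of t] X1[OF that]
    by (simp add: V2_def E_def exp_minus field_simps)
  have D0: "((\<lambda>t. \<gamma> t $ 0) has_real_derivative V0 t) (at t)" if "t \<in> I" for t
    using DX[OF that, of 0] V0[OF that] by simp
  have D2: "((\<lambda>t. \<gamma> t $ 2) has_real_derivative V2 t) (at t)" if "t \<in> I" for t
    using DX[OF that, of 2] V2[OF that] by simp
  have D3: "((\<lambda>t. \<gamma> t $ 3) has_real_derivative \<phi>3) (at t)" if "t \<in> I" for t
    using DX[OF that, of 3] phi3[OF that] by simp
  have "\<gamma> t $ 0 = X0 t" if "t \<in> I" for t
    by (rule same_DERIV_on_interval_eq[OF I _ D0 DERIV_X0 that]) (auto simp: start X_at_0)
  moreover have "\<gamma> t $ 2 = X2 t" if "t \<in> I" for t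
    by (rule same_DERIV_on_interval_eq[OF I _ D2 DERIV_X2 that]) (auto simp: start X_at_0)
  moreover have "\<gamma> t $ 3 = \<phi>3 * t" if "t \<in> I" for t
    by (rule same_DERIV_on_interval_eq[OF I _ D3 DERIV_cmult_Id that]) (auto simp: start)
  moreover have "1 + \<phi>3\<^sup>2 = \<phi>\<^sup>2 * (1 - 2 * q\<^sup>2)"
    using phi_pos by (simp add: q2 s2_def field_simps)
  ultimately show thesis
    using that[OF orbit, of \<phi>3 t0] e0 X1 by blast
qed

section \<open>Every explicit orbit is a unit speed geodesic\<close>

context goedel_orbit
begin

context
  fixes \<gamma> :: "real \<Rightarrow> real^4" and I :: "real set" and \<phi>3 :: real
  assumes "open I"
    and coords: "\<forall>t\<in>I. \<gamma> t $ 0 = X0 t \<and> \<gamma> t $ 1 = X1 t \<and> \<gamma> t $ 2 = X2 t \<and> \<gamma> t $ 3 = \<phi>3 * t"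
begin

definition orbit_velocity :: "real \<Rightarrow> real^4" where
  "orbit_velocity t = (\<chi> k. if k = 0 then V0 t else if k = 1 then V1 t else if k = 2 then V2 t else \<phi>3)"

lemma DERIV_coords:
  assumes "t \<in> I"
  shows "((\<lambda>t. \<gamma> t $ k) has_real_derivative orbit_velocity t $ k) (at t)"
proof -
  note transform = has_field_derivative_transform_within_open[OF _ \<open>open I\<close> assms]
  have "\<forall>k. ((\<lambda>t. \<gamma> t $ k) has_real_derivative orbit_velocity t $ k) (at t)"
    unfolding forall_0123
    using coords
    by (auto simp: orbit_velocity_def
        intro: transform[OF DERIV_X0] transform[OF DERIV_X1] transform[OF DERIV_X2]
          transform[OF DERIV_cmult_Id])
  then show ?thesis by blast
qed

lemma orbit_geodesic: "geodesic_on goedel_metric I \<gamma>"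
proof (rule geodesic_onI[OF \<open>open I\<close> DERIV_coords])
  fix t k assume t: "t \<in> I"
  have "\<forall>k. ((\<lambda>t. orbit_velocity t $ k) has_real_derivative - (\<Sum>i\<in>UNIV. \<Sum>j\<in>UNIV.
      christoffel goedel_metric (\<gamma> t) k i j * orbit_velocity t $ i * orbit_velocity t $ j)) (at t)"
    unfolding forall_0123 christoffel_sum_goedel
    using coords t DERIV_V0[of t] DERIV_V1[of t] DERIV_V2[of t] by (simp add: orbit_velocity_def)
  then show "((\<lambda>t. orbit_velocity t $ k) has_real_derivative - (\<Sum>i\<in>UNIV. \<Sum>j\<in>UNIV.
      christoffel goedel_metric (\<gamma> t) k i j * orbit_velocity t $ i * orbit_velocity t $ j)) (at t)"
    by blast
qed

lemma orbit_velocity: "t \<in> I \<Longrightarrow> velocity \<gamma> t = orbit_velocity t"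
  by (intro velocity_eqI DERIV_coords)

lemma orbit_e0_component: "t \<in> I \<Longrightarrow> e0_component (\<gamma> t) (velocity \<gamma> t) = \<phi>"
  using coords e0_V[of t] by (simp add: e0_component_def orbit_velocity orbit_velocity_def)

text \<open>By \<open>energy_V\<close> the form equals \<phi>^2 - 2 \<phi>^2 q^2 - \<phi>3^2, and
  the relation between \<open>\<phi>3\<close> and \<open>q\<close> makes this 1.\<close>

lemma orbit_metric_form:
  assumes "t \<in> I" and "1 + \<phi>3\<^sup>2 = \<phi>\<^sup>2 * (1 - 2 * q\<^sup>2)"
  shows "metric_form goedel_metric (\<gamma> t) (velocity \<gamma> t) (velocity \<gamma> t) = 1"
  using assms coords energy_V[of t] orbit_e0_component[OF assms(1)]
  by (simp add: metric_form_goedel) (simp add: orbit_velocity orbit_velocity_def algebra_simps)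

end

end

text \<open>Both forms of the classification are treated here as one family, with q = 0 allowed.
  Leaving \<open>G0\<close> amounts to \<phi>3 being nonzero.\<close>

theorem goedel_geodesic_iff:
  fixes \<gamma> :: "real \<Rightarrow> real^4" and I :: "real set"
  assumes I: "open I" "is_interval I" "0 \<in> I"
  shows
    "(geodesic_on goedel_metric I \<gamma>
      \<and> (\<forall>t\<in>I. metric_form goedel_metric (\<gamma> t) (velocity \<gamma> t) (velocity \<gamma> t) = 1)
      \<and> future_directed_on I \<gamma>
      \<and> \<gamma> 0 = 0
      \<and> \<not> \<gamma> ` I \<subseteq> G0)
     \<longleftrightarrow>
     (\<exists>\<phi> q \<omega> t0 \<phi>3. goedel_orbit \<phi> q \<omega> \<and> \<phi>3 \<noteq> 0 \<and> 1 + \<phi>3\<^sup>2 = \<phi>\<^sup>2 * (1 - 2 * q\<^sup>2) \<and>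
       (\<forall>t\<in>I. e0_component (\<gamma> t) (velocity \<gamma> t) = \<phi>) \<and>
       (\<forall>t\<in>I. \<gamma> t $ 0 = goedel_orbit.X0 \<phi> q \<omega> t0 t \<and> \<gamma> t $ 1 = goedel_orbit.X1 q \<omega> t0 t \<and>
          \<gamma> t $ 2 = goedel_orbit.X2 \<phi> q \<omega> t0 t \<and> \<gamma> t $ 3 = \<phi>3 * t))"
    (is "?geodesic \<longleftrightarrow> ?orbit")
proof
  assume ?geodesic
  then have geodesic: "geodesic_on goedel_metric I \<gamma>"
      "\<forall>t\<in>I. metric_form goedel_metric (\<gamma> t) (velocity \<gamma> t) (velocity \<gamma> t) = 1"
      "future_directed_on I \<gamma>" "\<gamma> 0 = 0" and "\<not> \<gamma> ` I \<subseteq> G0"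
    by blast+
  obtain \<phi> q \<omega> t0 \<phi>3 where "goedel_orbit \<phi> q \<omega>" "1 + \<phi>3\<^sup>2 = \<phi>\<^sup>2 * (1 - 2 * q\<^sup>2)"
    "\<forall>t\<in>I. e0_component (\<gamma> t) (velocity \<gamma> t) = \<phi>"
    and coords: "\<forall>t\<in>I. \<gamma> t $ 0 = goedel_orbit.X0 \<phi> q \<omega> t0 t \<and> \<gamma> t $ 1 = goedel_orbit.X1 q \<omega> t0 t \<and>
      \<gamma> t $ 2 = goedel_orbit.X2 \<phi> q \<omega> t0 t \<and> \<gamma> t $ 3 = \<phi>3 * t"
    by (rule goedel_geodesic_normal_form[OF I(2,3) geodesic])
  moreover have "\<phi>3 \<noteq> 0"
    using \<open>\<not> \<gamma> ` I \<subseteq> G0\<close> coords by (auto simp: G0_def)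
  ultimately show ?orbit by blast
next
  assume ?orbit
  then obtain \<phi> q \<omega> t0 \<phi>3 where orbit: "goedel_orbit \<phi> q \<omega>" and "\<phi>3 \<noteq> 0"
    and phi3: "1 + \<phi>3\<^sup>2 = \<phi>\<^sup>2 * (1 - 2 * q\<^sup>2)"
    and coords: "\<forall>t\<in>I. \<gamma> t $ 0 = goedel_orbit.X0 \<phi> q \<omega> t0 t \<and> \<gamma> t $ 1 = goedel_orbit.X1 q \<omega> t0 t \<and>
      \<gamma> t $ 2 = goedel_orbit.X2 \<phi> q \<omega> t0 t \<and> \<gamma> t $ 3 = \<phi>3 * t"
    by blast
  interpret goedel_orbit \<phi> q \<omega> t0
    by (rule orbit)
  have "\<gamma> 0 = 0"
    using coords I(3) by (auto simp: vec_eq_iff forall_0123 X_at_0)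
  moreover have "\<not> \<gamma> ` I \<subseteq> G0"
  proof -
    \<comment> \<open>At time 0 the curve lies in \<open>G0\<close>, so a nonzero time in
      \<open>I\<close> is needed; openness of \<open>I\<close> provides one.\<close>
    obtain e where e: "e > 0" "ball 0 e \<subseteq> I"
      using I open_contains_ball by blast
    have "e / 2 \<in> ball 0 e"
      using e(1) by (simp add: dist_real_def)
    then have "e / 2 \<in> I"
      using e(2) by blast
    moreover from this have "\<gamma> (e / 2) $ 3 \<noteq> 0"
      using coords \<open>\<phi>3 \<noteq> 0\<close> e(1) by simp
    ultimately show ?thesis
      by (auto simp: G0_def)
  qed
  ultimately show ?geodesic
    using orbit_geodesic[OF I(1) coords] orbit_metric_form[OF I(1) coords _ phi3]
      orbit_e0_component[OF I(1) coords] \<phi>_pos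
    by (auto simp: future_directed_on_def)
qed

section \<open>Translation into the forms (i) and (ii)\<close>

lemma arctan_tan_1: "arctan_tan 1 s = s"
  by (simp add: arctan_tan_eq)

text \<open>At q = 0 the factor in the arctangent is 1, so the branch is the identity, and sqrt 2 *
  \<omega> = 2 \<phi> turns x_0 into - \<phi> t + 2 \<phi> t.\<close>

lemma goedel_orbit_circular:
  assumes "goedel_orbit \<phi> 0 \<omega>"
  shows "goedel_orbit.X0 \<phi> 0 \<omega> t0 t = \<phi> * t"
    and "goedel_orbit.X1 0 \<omega> t0 t = 0"
    and "goedel_orbit.X2 \<phi> 0 \<omega> t0 t = 0"
proof -
  interpret goedel_orbit \<phi> 0 \<omega> t0
    by (rule assms)
  have "\<omega>\<^sup>2 = (sqrt 2 * \<phi>)\<^sup>2"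
    using \<omega>_sq by (simp add: power_mult_distrib)
  then have "\<omega> = sqrt 2 * \<phi>"
    by (rule power2_eq_imp_eq) (use \<omega>_pos \<phi>_pos in auto)
  then have "sqrt 2 * \<omega> = 2 * \<phi>"
    by simp
  moreover have "X0 t = - \<phi> * t + sqrt 2 * \<omega> * t"
    by (simp add: X0_def arctan_tan_1 field_simps)
  ultimately show "X0 t = \<phi> * t"
    by simp
  show "X1 t = 0" "X2 t = 0"
    by (simp_all add: X1_def X2_def N_def)
qed

text \<open>The root occurring in \<alpha> is sqrt 2 * q. Cancelling sqrt 2 gives \<alpha> = (1 - q)
  / (1 + q), and the remaining constants follow.\<close>

lemma goedel_orbit_eccentric:
  fixes \<phi> \<phi>3 q \<alpha> \<omega> \<beta> t0 :: real
  assumes \<phi>: "\<phi> > 0" and le: "1 + \<phi>3\<^sup>2 \<le> \<phi>\<^sup>2"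
    and q_def: "q = sqrt (1 - (1 + \<phi>3\<^sup>2) / \<phi>\<^sup>2) / sqrt 2"
    and \<alpha>_def: "\<alpha> = (sqrt 2 - sqrt (1 - (1 + \<phi>3\<^sup>2) / \<phi>\<^sup>2)) / (sqrt 2 + sqrt (1 - (1 + \<phi>3\<^sup>2) / \<phi>\<^sup>2))"
    and \<omega>_def: "\<omega> = sqrt (\<phi>\<^sup>2 + 1 + \<phi>3\<^sup>2)"
    and \<beta>_def: "\<beta> = sqrt (2 * (\<phi>\<^sup>2 - (1 + \<phi>3\<^sup>2))) / sqrt (\<phi>\<^sup>2 + 1 + \<phi>3\<^sup>2)
                * ((1 + \<alpha>) + (1 - \<alpha>) * cos (\<omega> * t0))"
  shows "goedel_orbit \<phi> q \<omega>"
    and "1 + \<phi>3\<^sup>2 = \<phi>\<^sup>2 * (1 - 2 * q\<^sup>2)"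
    and "goedel_orbit.X0 \<phi> q \<omega> t0 t = - \<phi> * (t - t0)
           + 2 * sqrt 2 * arctan_tan (sqrt \<alpha>) (\<omega> * (t - t0) / 2)
           - (\<phi> * t0 + 2 * sqrt 2 * arctan_tan (sqrt \<alpha>) (- \<omega> * t0 / 2))"
    and "goedel_orbit.X1 q \<omega> t0 t = eval_between (\<lambda>\<tau>. ln ((1 + \<alpha>) + (1 - \<alpha>) * cos \<tau>))
           (- \<omega> * t0) (\<omega> * (t - t0))"
    and "goedel_orbit.X2 \<phi> q \<omega> t0 t = eval_between (\<lambda>\<tau>. \<beta> * sin \<tau> / ((1 + \<alpha>) + (1 - \<alpha>) * cos \<tau>))
           (- \<omega> * t0) (\<omega> * (t - t0))"
proof -
  define r where "r = sqrt (1 - (1 + \<phi>3\<^sup>2) / \<phi>\<^sup>2)"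
  have "1 + \<phi>3\<^sup>2 > 0"
    by (simp add: add_pos_nonneg)
  have r: "r \<ge> 0" "r\<^sup>2 = 1 - (1 + \<phi>3\<^sup>2) / \<phi>\<^sup>2" "r\<^sup>2 < 1"
    using \<phi> le \<open>1 + \<phi>3\<^sup>2 > 0\<close> by (auto simp: r_def)
  have q_r: "q = r / sqrt 2"
    by (simp add: q_def r_def)
  have q2: "q\<^sup>2 = r\<^sup>2 / 2" and q_nonneg: "q \<ge> 0"
    using r(1) by (auto simp: q_r power_divide)
  have "q\<^sup>2 < 1\<^sup>2"
    using r by (simp add: q2)
  then have q_less_1: "q < 1"
    by (rule power2_less_imp_less) simp
  show phi3: "1 + \<phi>3\<^sup>2 = \<phi>\<^sup>2 * (1 - 2 * q\<^sup>2)"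
    using \<phi> by (simp add: q2 r(2) field_simps)
  have \<omega>2: "\<omega>\<^sup>2 = \<phi>\<^sup>2 + 1 + \<phi>3\<^sup>2"
    by (simp add: \<omega>_def)
  have \<omega>_pos: "\<omega> > 0"
    using \<open>1 + \<phi>3\<^sup>2 > 0\<close> \<phi> unfolding \<omega>_def by (simp add: add_pos_nonneg)
  show orbit: "goedel_orbit \<phi> q \<omega>"
    using \<phi> q_nonneg q_less_1 \<omega>_pos \<omega>2 phi3 by unfold_locales (auto simp: algebra_simps)
  interpret goedel_orbit \<phi> q \<omega> t0
    by (rule orbit)
  have "\<alpha> = (sqrt 2 - sqrt 2 * q) / (sqrt 2 + sqrt 2 * q)"
    by (simp add: \<alpha>_def r_def[symmetric] q_r)
  also have "\<dots> = (sqrt 2 * (1 - q)) / (sqrt 2 * (1 + q))"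
    by (simp add: algebra_simps)
  also have "\<dots> = (1 - q) / (1 + q)"
    by simp
  finally have \<alpha>: "\<alpha> = (1 - q) / (1 + q)" .
  then show "X0 t = - \<phi> * (t - t0)
           + 2 * sqrt 2 * arctan_tan (sqrt \<alpha>) (\<omega> * (t - t0) / 2)
           - (\<phi> * t0 + 2 * sqrt 2 * arctan_tan (sqrt \<alpha>) (- \<omega> * t0 / 2))"
    by (simp add: X0_def algebra_simps)
  \<comment> \<open>The constant 2 / (1 + q) drops out of the difference of logarithms in x_1 and is
    absorbed by \<beta> in x_2.\<close>
  have denominator: "(1 + \<alpha>) + (1 - \<alpha>) * cos (\<omega> * (s - t0)) = 2 / (1 + q) * N s" for s
  proof -
    have "1 + \<alpha> = 2 / (1 + q)" "1 - \<alpha> = 2 / (1 + q) * q"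
      using q_nonneg by (simp_all add: \<alpha> field_simps)
    then show ?thesis
      by (simp add: N_def distrib_left)
  qed
  have denominator0: "(1 + \<alpha>) + (1 - \<alpha>) * cos (- \<omega> * t0) = 2 / (1 + q) * N 0"
    using denominator[of 0] by simp
  show "X1 t = eval_between (\<lambda>\<tau>. ln ((1 + \<alpha>) + (1 - \<alpha>) * cos \<tau>))
           (- \<omega> * t0) (\<omega> * (t - t0))"
    unfolding eval_between_def denominator denominator0 X1_def
    using N_pos[of t] N_pos[of 0] q_nonneg by (simp add: ln_mult ln_div)
  have "sqrt (2 * (\<phi>\<^sup>2 - (1 + \<phi>3\<^sup>2))) = sqrt ((2 * \<phi> * q)\<^sup>2)"
    unfolding phi3 by (simp add: power_mult_distrib algebra_simps)
  then have "sqrt (2 * (\<phi>\<^sup>2 - (1 + \<phi>3\<^sup>2))) = 2 * \<phi> * q"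
    using \<phi> q_nonneg by (simp add: real_sqrt_abs)
  then have \<beta>: "\<beta> = 2 / (1 + q) * (2 * \<phi> * q / \<omega> * N 0)"
    unfolding \<beta>_def \<omega>_def[symmetric] using denominator0 by simp
  have "\<beta> * x / (2 / (1 + q) * n) = 2 * \<phi> * q / \<omega> * N 0 * (x / n)" for x n
    unfolding \<beta> using q_nonneg
    by (subst mult.assoc, subst mult_divide_mult_cancel_left) auto
  then show "X2 t = eval_between (\<lambda>\<tau>. \<beta> * sin \<tau> / ((1 + \<alpha>) + (1 - \<alpha>) * cos \<tau>))
           (- \<omega> * t0) (\<omega> * (t - t0))"
    unfolding eval_between_def denominator denominator0
    by (simp only: X2_def right_diff_distrib)
qed

text \<open>The sign \<open>\<sigma>\<close> accounts for both directions along x_3: reflecting this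
  coordinate is an isometry fixing the unit. The equivalence also asserts that every curve of either
  form is such a geodesic.\<close>

theorem theorem5:
  fixes \<gamma> :: "real \<Rightarrow> real^4" and I :: "real set"
  assumes "open I" and "is_interval I" and "0 \<in> I"
  shows
    "(geodesic_on goedel_metric I \<gamma>
      \<and> (\<forall>t\<in>I. metric_form goedel_metric (\<gamma> t) (velocity \<gamma> t) (velocity \<gamma> t) = 1)
      \<and> future_directed_on I \<gamma>
      \<and> \<gamma> 0 = 0
      \<and> \<not> \<gamma> ` I \<subseteq> G0)
     \<longleftrightarrow>
     (\<exists>\<phi>\<^sub>0>0. (\<forall>t\<in>I. e0_component (\<gamma> t) (velocity \<gamma> t) = \<phi>\<^sub>0) \<and>
       ((\<phi>\<^sub>0 > 1 \<and>
         (\<exists>\<sigma>\<in>{1, -1}. \<forall>t\<in>I.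
            \<gamma> t $ 0 = \<phi>\<^sub>0 * t \<and>
            \<gamma> t $ 3 = \<sigma> * sqrt (\<phi>\<^sub>0\<^sup>2 - 1) * t \<and>
            \<gamma> t $ 1 = 0 \<and>
            \<gamma> t $ 2 = 0))
        \<or>
        (\<exists>\<phi>\<^sub>3 t\<^sub>0 \<alpha> \<omega> \<beta>.
          0 < \<bar>\<phi>\<^sub>3\<bar> \<and> \<bar>\<phi>\<^sub>3\<bar> < sqrt (\<phi>\<^sub>0\<^sup>2 - 1) \<and>
          \<alpha> = (sqrt 2 - sqrt (1 - (1 + \<phi>\<^sub>3\<^sup>2) / \<phi>\<^sub>0\<^sup>2)) / (sqrt 2 + sqrt (1 - (1 + \<phi>\<^sub>3\<^sup>2) / \<phi>\<^sub>0\<^sup>2)) \<and>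
          \<omega> = sqrt (\<phi>\<^sub>0\<^sup>2 + 1 + \<phi>\<^sub>3\<^sup>2) \<and>
          \<beta> = sqrt (2 * (\<phi>\<^sub>0\<^sup>2 - (1 + \<phi>\<^sub>3\<^sup>2))) / sqrt (\<phi>\<^sub>0\<^sup>2 + 1 + \<phi>\<^sub>3\<^sup>2)
                * ((1 + \<alpha>) + (1 - \<alpha>) * cos (\<omega> * t\<^sub>0)) \<and>
          (\<forall>t\<in>I.
            \<gamma> t $ 0 = - \<phi>\<^sub>0 * (t - t\<^sub>0)
                + 2 * sqrt 2 * arctan_tan (sqrt \<alpha>) (\<omega> * (t - t\<^sub>0) / 2)
                - (\<phi>\<^sub>0 * t\<^sub>0 + 2 * sqrt 2 * arctan_tan (sqrt \<alpha>) (- \<omega> * t\<^sub>0 / 2)) \<and>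
            \<gamma> t $ 1 = eval_between (\<lambda>\<tau>. ln ((1 + \<alpha>) + (1 - \<alpha>) * cos \<tau>))
                (- \<omega> * t\<^sub>0) (\<omega> * (t - t\<^sub>0)) \<and>
            \<gamma> t $ 2 = eval_between (\<lambda>\<tau>. \<beta> * sin \<tau> / ((1 + \<alpha>) + (1 - \<alpha>) * cos \<tau>))
                (- \<omega> * t\<^sub>0) (\<omega> * (t - t\<^sub>0)) \<and>
            \<gamma> t $ 3 = \<phi>\<^sub>3 * t))))"
    (is "?geodesic \<longleftrightarrow> (\<exists>\<phi>>0. ?e0 \<phi> \<and> (?circular \<phi> \<or> (\<exists>\<phi>3 t0 \<alpha> \<omega> \<beta>. ?eccentric \<phi> \<phi>3 t0 \<alpha> \<omega> \<beta>)))"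
      is "_ \<longleftrightarrow> ?forms")
proof
  assume ?geodesic
  then obtain \<phi> q \<omega> t0 \<phi>3 where orbit: "goedel_orbit \<phi> q \<omega>" and "\<phi>3 \<noteq> 0"
    and phi3: "1 + \<phi>3\<^sup>2 = \<phi>\<^sup>2 * (1 - 2 * q\<^sup>2)"
    and e0: "\<forall>t\<in>I. e0_component (\<gamma> t) (velocity \<gamma> t) = \<phi>"
    and coords: "\<forall>t\<in>I. \<gamma> t $ 0 = goedel_orbit.X0 \<phi> q \<omega> t0 t \<and> \<gamma> t $ 1 = goedel_orbit.X1 q \<omega> t0 t \<and>
      \<gamma> t $ 2 = goedel_orbit.X2 \<phi> q \<omega> t0 t \<and> \<gamma> t $ 3 = \<phi>3 * t"
    unfolding goedel_geodesic_iff[OF assms] by blast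
  interpret goedel_orbit \<phi> q \<omega> t0
    by (rule orbit)
  show ?forms
  \<comment> \<open>Eccentricity 0 leads to form (i), positive eccentricity to form (ii).\<close>
  proof (intro exI[of _ \<phi>] conjI \<phi>_pos e0, cases "q = 0")
    case True
    have "\<phi>3\<^sup>2 > 0"
      using \<open>\<phi>3 \<noteq> 0\<close> by simp
    moreover have "\<phi>\<^sup>2 = 1 + \<phi>3\<^sup>2"
      using phi3 True by simp
    ultimately have "1\<^sup>2 < \<phi>\<^sup>2"
      by simp
    then have "\<phi> > 1"
      by (rule power2_less_imp_less) (use \<phi>_pos in simp)
    moreover have "\<phi>3 = sgn \<phi>3 * sqrt (\<phi>\<^sup>2 - 1)"
    proof -
      have "\<phi>\<^sup>2 - 1 = \<phi>3\<^sup>2"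
        using phi3 True by simp
      then show ?thesis
        by (simp add: sgn_mult_abs)
    qed
    moreover have "sgn \<phi>3 \<in> {1, - 1}"
      using \<open>\<phi>3 \<noteq> 0\<close> by (simp add: sgn_if)
    ultimately have "?circular \<phi>"
      using coords orbit unfolding True
      by (intro conjI bexI[of _ "sgn \<phi>3"]) (simp_all add: goedel_orbit_circular)
    then show "?circular \<phi> \<or> (\<exists>\<phi>3 t0 \<alpha> \<omega> \<beta>. ?eccentric \<phi> \<phi>3 t0 \<alpha> \<omega> \<beta>)" ..
  next
    case False
    \<comment> \<open>Since \<phi>3^2 = \<phi>^2 - 1 - 2 \<phi>^2 q^2, this is the strictness of the
      bound on \<open>\<phi>3\<close>.\<close>
    have "\<phi>\<^sup>2 * q\<^sup>2 > 0"
      using \<phi>_pos False by simp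
    then have "\<phi>3\<^sup>2 < \<phi>\<^sup>2 - 1"
      using phi3 by (simp add: algebra_simps)
    then have "\<bar>\<phi>3\<bar> < sqrt (\<phi>\<^sup>2 - 1)" and le: "1 + \<phi>3\<^sup>2 \<le> \<phi>\<^sup>2"
      using real_less_rsqrt[of "\<bar>\<phi>3\<bar>"] by auto
    have "1 - (1 + \<phi>3\<^sup>2) / \<phi>\<^sup>2 = 2 * q\<^sup>2"
      using \<phi>_pos unfolding phi3 by simp
    then have q_eq: "sqrt (1 - (1 + \<phi>3\<^sup>2) / \<phi>\<^sup>2) / sqrt 2 = q"
      using q_nonneg by (simp add: real_sqrt_mult)
    have "\<phi>\<^sup>2 + 1 + \<phi>3\<^sup>2 = \<omega>\<^sup>2"
      unfolding \<omega>_sq using phi3 by (simp add: algebra_simps)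
    then have \<omega>_eq: "sqrt (\<phi>\<^sup>2 + 1 + \<phi>3\<^sup>2) = \<omega>"
      using \<omega>_pos by simp
    note eccentric = goedel_orbit_eccentric(3-5)
      [OF \<phi>_pos le q_eq[symmetric] refl \<omega>_eq[symmetric] refl, of t0]
    show "?circular \<phi> \<or> (\<exists>\<phi>3 t0 \<alpha> \<omega> \<beta>. ?eccentric \<phi> \<phi>3 t0 \<alpha> \<omega> \<beta>)"
      using coords \<open>\<phi>3 \<noteq> 0\<close> \<open>\<bar>\<phi>3\<bar> < sqrt (\<phi>\<^sup>2 - 1)\<close>
      by (intro disjI2 exI[of _ \<phi>3] exI[of _ t0] exI[of _ \<omega>] exI conjI refl \<omega>_eq[symmetric])
        (simp_all only: eccentric zero_less_abs_iff not_False_eq_True)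
  qed
next
  assume ?forms
  then obtain \<phi> where "\<phi> > 0" and e0: "?e0 \<phi>"
    and forms: "?circular \<phi> \<or> (\<exists>\<phi>3 t0 \<alpha> \<omega> \<beta>. ?eccentric \<phi> \<phi>3 t0 \<alpha> \<omega> \<beta>)"
    by blast
  from forms show ?geodesic
  proof (elim disjE exE)
    assume "?circular \<phi>"
    then obtain \<sigma> where "\<phi> > 1" and \<sigma>: "\<sigma> \<in> {1, - 1}"
      and coords: "\<forall>t\<in>I. \<gamma> t $ 0 = \<phi> * t \<and> \<gamma> t $ 3 = \<sigma> * sqrt (\<phi>\<^sup>2 - 1) * t \<and> \<gamma> t $ 1 = 0 \<and> \<gamma> t $ 2 = 0"
      by blast
    define \<phi>3 where "\<phi>3 = \<sigma> * sqrt (\<phi>\<^sup>2 - 1)"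
    have "\<phi>\<^sup>2 > 1"
      using \<open>\<phi> > 1\<close> by simp
    then have "\<phi>3 \<noteq> 0" "1 + \<phi>3\<^sup>2 = \<phi>\<^sup>2 * (1 - 2 * 0\<^sup>2)"
      using \<sigma> by (auto simp: \<phi>3_def)
    moreover have orbit: "goedel_orbit \<phi> 0 (sqrt 2 * \<phi>)"
      using \<open>\<phi> > 0\<close> by unfold_locales (simp_all add: power_mult_distrib)
    ultimately show ?geodesic
      unfolding goedel_geodesic_iff[OF assms] using e0 coords
      by (intro exI[of _ \<phi>] exI[of _ 0] exI[of _ "sqrt 2 * \<phi>"] exI[of _ \<phi>3])
        (simp add: goedel_orbit_circular[OF orbit] \<phi>3_def)
  next
    fix \<phi>3 t0 \<alpha> \<omega> \<beta>
    define q where "q = sqrt (1 - (1 + \<phi>3\<^sup>2) / \<phi>\<^sup>2) / sqrt 2"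
    assume form: "?eccentric \<phi> \<phi>3 t0 \<alpha> \<omega> \<beta>"
    then have "\<phi>3 \<noteq> 0"
      by simp
    \<comment> \<open>\<open>sqrt\<close> of a negative number is negative, so nonnegativity of the
      root shows that the radicand is nonnegative and that squaring the root recovers it.\<close>
    have "0 \<le> sqrt (\<phi>\<^sup>2 - 1)"
      using form by linarith
    moreover have "\<bar>\<phi>3\<bar>\<^sup>2 \<le> (sqrt (\<phi>\<^sup>2 - 1))\<^sup>2"
      using form by (intro power_mono) auto
    ultimately have le: "1 + \<phi>3\<^sup>2 \<le> \<phi>\<^sup>2"
      by simp
    have \<alpha>: "\<alpha> = (sqrt 2 - sqrt (1 - (1 + \<phi>3\<^sup>2) / \<phi>\<^sup>2)) / (sqrt 2 + sqrt (1 - (1 + \<phi>3\<^sup>2) / \<phi>\<^sup>2))"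
      using form by (elim conjE)
    have \<omega>: "\<omega> = sqrt (\<phi>\<^sup>2 + 1 + \<phi>3\<^sup>2)"
      using form by (elim conjE)
    have \<beta>: "\<beta> = sqrt (2 * (\<phi>\<^sup>2 - (1 + \<phi>3\<^sup>2))) / sqrt (\<phi>\<^sup>2 + 1 + \<phi>3\<^sup>2)
        * ((1 + \<alpha>) + (1 - \<alpha>) * cos (\<omega> * t0))"
      using form by (elim conjE)
    note eccentric = goedel_orbit_eccentric[OF \<open>\<phi> > 0\<close> le q_def \<alpha> \<omega> \<beta>]
    have "\<forall>t\<in>I. \<gamma> t $ 0 = goedel_orbit.X0 \<phi> q \<omega> t0 t \<and> \<gamma> t $ 1 = goedel_orbit.X1 q \<omega> t0 t \<and>
        \<gamma> t $ 2 = goedel_orbit.X2 \<phi> q \<omega> t0 t \<and> \<gamma> t $ 3 = \<phi>3 * t"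
      unfolding eccentric(3-5) using form by (elim conjE)
    with eccentric(1) \<open>\<phi>3 \<noteq> 0\<close> eccentric(2) e0 show ?geodesic
      unfolding goedel_geodesic_iff[OF assms] by (intro exI conjI)
  qed
qed

end
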